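(* Let $m\ge 2$ and $1\le i\le m-1$ be integers. Then $$(m+i+1)\,D_{i+1}(m)\cdot(m-i+1)\,D_{i-1}(m)<(m+i)(m-i+1)\,D_i(m)^2,$$ where $D_j(m)=\binom{2m}{m-j}\,m!\,j!\,(m-j)!\,2^j\,d_j(m)$ for $0\le j\le m$ and $d_j(m)$ is the coefficient of $a^j$ in the Boros-Moll polynomial $P_m(a)$.
   Context: The Boros-Moll polynomials are $P_m(a)=2^{-2m}\sum_{k=0}^{m}2^k\binom{2m-2k}{m-k}\binom{m+k}{k}(a+1)^k$ for integers $m\ge 0$ (equivalently, $P_m(a)=\sum_{j,k}\binom{2m+1}{2j}\binom{m-j}{k}\binom{2k+2j}{k+j}\frac{(a+1)^j(a-1)^k}{2^{3(k+j)}}$). The coefficient of $a^j$ in $P_m(a)$ is $$d_j(m)=2^{-2m}\sum_{k=j}^{m}2^k\binom{2m-2k}{m-k}\binom{m+k}{k}\binom{k}{j}.$$ *)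

theory Defs
  imports Complex_Main "HOL-Computational_Algebra.Polynomial"
begin

text \<open>The variable $a$ of $P_m(a)$ is the polynomial indeterminate, so
  \<open>[:1, 1:]\<close> is $a + 1$.\<close>

definition boros_moll :: "nat \<Rightarrow> real poly" where
  "boros_moll m =
     smult (1 / 2 ^ (2 * m))
       (\<Sum>k = 0..m. smult (2 ^ k * real ((2 * m - 2 * k) choose (m - k)) * real ((m + k) choose k))
                       ([:1, 1:] ^ k))"

definition boros_moll_coeff :: "nat \<Rightarrow> nat \<Rightarrow> real" where
  "boros_moll_coeff j m = coeff (boros_moll m) j"

text \<open>Only meaningful for $j \le m$, as $m - j$ is truncated subtraction.\<close>

definition boros_moll_D :: "nat \<Rightarrow> nat \<Rightarrow> real" where
  "boros_moll_D j m =
     real ((2 * m) choose (m - j)) * fact m * fact j * fact (m - j) * 2 ^ j * boros_moll_coeff j m"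

lemma coeff_one_plus_power: "coeff ([:1, 1:] ^ k :: real poly) j = real (k choose j)"
proof (induction k arbitrary: j)
  case 0
  then show ?case by (cases j) auto
next
  case (Suc k)
  then show ?case by (cases j) (auto simp: coeff_pCons)
qed

lemma boros_moll_coeff_explicit:
  "boros_moll_coeff j m =
     1 / 2 ^ (2 * m) *
       (\<Sum>k = j..m. 2 ^ k * real ((2 * m - 2 * k) choose (m - k)) * real ((m + k) choose k)
                       * real (k choose j))"
proof -
  have "(\<Sum>k = j..m. 2 ^ k * real ((2 * m - 2 * k) choose (m - k)) * real ((m + k) choose k)
           * real (k choose j)) =
        (\<Sum>k = 0..m. 2 ^ k * real ((2 * m - 2 * k) choose (m - k)) * real ((m + k) choose k)
           * real (k choose j))"
    by (rule sum.mono_neutral_left) auto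
  then show ?thesis
    by (simp add: boros_moll_coeff_def boros_moll_def coeff_sum coeff_one_plus_power)
qed

end

theory Submission
  imports Defs
begin

text \<open>
  Since \<open>D\<^sub>j(m) = (2m)! m! 2^j e\<^sub>j / (m + j)!\<close> with \<open>e\<^sub>j = j! d\<^sub>j(m)\<close>, the claimed inequality is
  equivalent to the strict log-concavity \<open>e\<^sub>i\<^sub>-\<^sub>1 e\<^sub>i\<^sub>+\<^sub>1 < e\<^sub>i\<^sup>2\<close>.

  The polynomial \<open>P\<^sub>m\<close> is a Jacobi polynomial and satisfies
  \<open>(1 - a\<^sup>2) P'' - (2a + 2m + 1) P' + m(m + 1) P = 0\<close>. Comparing coefficients of \<open>a\<^sup>n\<close> gives
  \<open>e\<^sub>n\<^sub>+\<^sub>2 = (2m + 1) e\<^sub>n\<^sub>+\<^sub>1 - c\<^sub>n e\<^sub>n\<close> with \<open>c\<^sub>n = (m - n)(m + n + 1)\<close>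
  (lemma \<open>fact_boros_moll_coeff_recurrence\<close>). The coefficient \<open>2m + 1\<close> does not depend on \<open>n\<close>,
  so eliminating it between two consecutive instances relates the Turan differences
  \<open>L\<^sub>n = e\<^sub>n\<^sup>2 - e\<^sub>n\<^sub>-\<^sub>1 e\<^sub>n\<^sub>+\<^sub>1\<close> by
  \<open>c\<^sub>n L\<^sub>n\<^sub>+\<^sub>1 = L\<^sub>n\<^sub>+\<^sub>2 + (c\<^sub>n - c\<^sub>n\<^sub>+\<^sub>1) e\<^sub>n\<^sub>+\<^sub>1\<^sup>2\<close>.
  As \<open>c\<close> is positive and decreasing below \<open>m\<close>, positivity of \<open>L\<close> propagates downwards
  from \<open>L\<^sub>m = e\<^sub>m\<^sup>2\<close> (lemma \<open>three_term_recurrence_log_concave\<close>).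
\<close>

section \<open>Log-concavity from a three-term recurrence\<close>

text \<open>The induction runs downwards from the top index, where the sequence stops and the
  Turan difference is a square.\<close>

lemma three_term_recurrence_log_concave:
  fixes e c :: "nat \<Rightarrow> real" and b :: real
  assumes rec: "\<And>n. e (n + 2) = b * e (n + 1) - c n * e n"
    and c_pos: "\<And>n. n < N \<Longrightarrow> 0 < c n"
    and c_dec: "\<And>n. n < N \<Longrightarrow> c (Suc n) \<le> c n"
    and top: "e N \<noteq> 0" "e (Suc N) = 0"
    and "n < N"
  shows "e n * e (n + 2) < (e (n + 1))\<^sup>2"
proof -
  obtain M where N: "N = Suc M"
    using \<open>n < N\<close> by (cases N) auto
  have "n \<le> M"
    using \<open>n < N\<close> N by simp
  then show ?thesis
  proof (induction rule: inc_induct)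
    case base
    show ?case
      using top N by simp
  next
    case (step k)
    have "k < N"
      using step N by simp
    have "c k * ((e (k + 1))\<^sup>2 - e k * e (k + 2))
        = ((e (k + 2))\<^sup>2 - e (k + 1) * e (k + 3)) + (c k - c (Suc k)) * (e (k + 1))\<^sup>2"
    proof -
      have "c k * e k = b * e (k + 1) - e (k + 2)"
        using rec[of k] by simp
      moreover have "e (k + 3) = b * e (k + 2) - c (Suc k) * e (k + 1)"
        using rec[of "Suc k"] by (simp add: numeral_3_eq_3)
      ultimately show ?thesis
        by algebra
    qed
    moreover have "0 \<le> (c k - c (Suc k)) * (e (k + 1))\<^sup>2"
      using c_dec[OF \<open>k < N\<close>] by simp
    moreover have "e (k + 1) * e (k + 3) < (e (k + 2))\<^sup>2"
      using step.IH by (simp add: numeral_3_eq_3)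
    ultimately have "0 < c k * ((e (k + 1))\<^sup>2 - e k * e (k + 2))"
      by linarith
    then show ?case
      using c_pos[OF \<open>k < N\<close>] by (simp add: zero_less_mult_iff)
  qed
qed

section \<open>Expansion in powers of \<open>a + 1\<close>\<close>

definition boros_moll_weight :: "nat \<Rightarrow> nat \<Rightarrow> real" where
  "boros_moll_weight m k =
     2 ^ k * real ((2 * m - 2 * k) choose (m - k)) * real ((m + k) choose k) / 2 ^ (2 * m)"

lemma boros_moll_coeff_weight:
  "boros_moll_coeff j m = (\<Sum>k\<le>m. boros_moll_weight m k * real (k choose j))"
proof -
  have "(\<Sum>k = j..m. boros_moll_weight m k * real (k choose j))
      = (\<Sum>k\<le>m. boros_moll_weight m k * real (k choose j))"
    by (rule sum.mono_neutral_left) auto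
  then show ?thesis
    by (simp add: boros_moll_coeff_explicit boros_moll_weight_def sum_divide_distrib)
qed

lemma boros_moll_coeff_pos:
  assumes "j \<le> m"
  shows "0 < boros_moll_coeff j m"
  unfolding boros_moll_coeff_weight
proof (rule sum_pos2)
  show "0 < boros_moll_weight m m * real (m choose j)"
    using assms by (simp add: boros_moll_weight_def)
qed (use assms in \<open>auto simp: boros_moll_weight_def\<close>)

lemma boros_moll_coeff_eq_0: "m < j \<Longrightarrow> boros_moll_coeff j m = 0"
  by (simp add: boros_moll_coeff_weight binomial_eq_0)

lemma central_binomial_Suc:
  "real (Suc r) * real ((2 * Suc r) choose Suc r)
     = 2 * (2 * real r + 1) * real ((2 * r) choose r)"
proof -
  have "Suc r * ((2 * Suc r) choose Suc r) = 2 * Suc r * (Suc (2 * r) choose r)"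
    using Suc_times_binomial[of r "Suc (2 * r)"] by simp
  moreover have "Suc r * (Suc (2 * r) choose r) = Suc (2 * r) * ((2 * r) choose r)"
    using binomial_absorb_comp[of "Suc (2 * r)" r] by simp
  ultimately have "Suc r * ((2 * Suc r) choose Suc r) = 2 * (2 * r + 1) * ((2 * r) choose r)"
    by simp
  then have "real (Suc r * ((2 * Suc r) choose Suc r))
      = real (2 * (2 * r + 1) * ((2 * r) choose r))"
    by (rule arg_cong)
  then show ?thesis
    unfolding of_nat_mult by simp
qed

text \<open>This is the differential equation of \<open>P\<^sub>m\<close> read off in powers of \<open>a + 1\<close>, where it
  becomes a two-term recurrence.\<close>

lemma boros_moll_weight_Suc:
  assumes "k < m"
  shows "(real m - real k) * (real m + real k + 1) * boros_moll_weight m k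
       = real (Suc k) * (2 * real m - 2 * real k - 1) * boros_moll_weight m (Suc k)"
proof -
  obtain r where m: "m = Suc k + r"
    using assms less_imp_Suc_add[of k m] by auto
  define A where "A = real ((2 * Suc r) choose Suc r)"
  define B where "B = real ((2 * r) choose r)"
  define C where "C = real ((m + k) choose k)"
  define C' where "C' = real ((m + Suc k) choose Suc k)"
  have "Suc k * ((m + Suc k) choose Suc k) = (m + k + 1) * ((m + k) choose k)"
    using Suc_times_binomial[of k "m + k"] by simp
  then have "real (Suc k * ((m + Suc k) choose Suc k)) = real ((m + k + 1) * ((m + k) choose k))"
    by (rule arg_cong)
  then have C: "real (Suc k) * C' = (real m + real k + 1) * C"
    unfolding C_def C'_def of_nat_mult by simp
  have A: "real (Suc r) * A = 2 * (2 * real r + 1) * B"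
    unfolding A_def B_def by (rule central_binomial_Suc)
  have "2 * m - 2 * k = 2 * Suc r" "m - k = Suc r" "2 * m - 2 * Suc k = 2 * r" "m - Suc k = r"
    using m by simp_all
  then have w: "boros_moll_weight m k = 2 ^ k * A * C / 2 ^ (2 * m)"
    "boros_moll_weight m (Suc k) = 2 * 2 ^ k * B * C' / 2 ^ (2 * m)"
    unfolding boros_moll_weight_def A_def B_def C_def C'_def by simp_all
  have r: "real m - real k = real (Suc r)" "2 * real m - 2 * real k - 1 = 2 * real r + 1"
    using m by simp_all
  have "(real m - real k) * (real m + real k + 1) * boros_moll_weight m k
      = (real (Suc r) * A) * ((real m + real k + 1) * C) * (2 ^ k / 2 ^ (2 * m))"
    unfolding w r by simp
  also have "\<dots> = (2 * (2 * real r + 1) * B) * (real (Suc k) * C') * (2 ^ k / 2 ^ (2 * m))"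
    unfolding A C ..
  also have "\<dots> = real (Suc k) * (2 * real m - 2 * real k - 1) * boros_moll_weight m (Suc k)"
    unfolding w r by simp
  finally show ?thesis .
qed

section \<open>The recurrence in powers of \<open>a\<close>\<close>

lemma binomial_Suc_right: "(real n + 1) * real (k choose Suc n) = (real k - real n) * real (k choose n)"
proof (cases "n \<le> k")
  case True
  have "Suc n * (k choose Suc n) = (k - n) * (k choose n)"
    by (metis Suc_times_binomial_eq binomial_absorb_comp mult.commute binomial_absorption diff_Suc_1)
  then have "real (Suc n * (k choose Suc n)) = real ((k - n) * (k choose n))"
    by (rule arg_cong)
  then show ?thesis
    using True unfolding of_nat_mult by (simp add: of_nat_diff add_ac)
qed (simp add: binomial_eq_0)

lemma binomial_pred_left: "real k * real ((k - 1) choose n) = (real k - real n) * real (k choose n)"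
proof (cases "n \<le> k")
  case True
  then have "real ((k - n) * (k choose n)) = real (k * ((k - 1) choose n))"
    by (simp only: binomial_absorb_comp)
  then show ?thesis
    using True by (simp add: of_nat_diff)
qed (simp add: binomial_eq_0)

text \<open>Both sides are the coefficient of \<open>a\<^sup>n\<close> in the differential operator of \<open>P\<^sub>m\<close> applied to
  \<open>(a + 1)\<^sup>k\<close>: on the left computed in powers of \<open>a\<close>, on the right in powers of \<open>a + 1\<close>.\<close>

lemma boros_moll_operator_binomial:
  fixes m :: real
  shows "(m - real n) * (m + real n + 1) * real (k choose n)
       - (real n + 1) * (2 * m + 1) * real (k choose Suc n)
       + (real n + 1) * (real n + 2) * real (k choose Suc (Suc n))
     = (m - real k) * (m + real k + 1) * real (k choose n)
       - real k * (2 * m + 1 - 2 * real k) * real ((k - 1) choose n)"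
proof -
  have "(real n + 2) * real (k choose Suc (Suc n)) = (real k - real n - 1) * real (k choose Suc n)"
    using binomial_Suc_right[of "Suc n" k] by (simp add: algebra_simps)
  then show ?thesis
    using binomial_Suc_right[of n k] binomial_pred_left[of k n] by algebra
qed

text \<open>Summed against the weights, the two terms on the right of
  \<open>boros_moll_operator_binomial\<close> are shifts of each other by \<open>boros_moll_weight_Suc\<close>,
  and the boundary terms carry the factors \<open>m - k\<close> at \<open>k = m\<close> and \<open>k\<close> at \<open>k = 0\<close>.\<close>

lemma boros_moll_coeff_recurrence:
  "(real m - real n) * (real m + real n + 1) * boros_moll_coeff n m
     - (real n + 1) * (2 * real m + 1) * boros_moll_coeff (n + 1) m
     + (real n + 1) * (real n + 2) * boros_moll_coeff (n + 2) m = 0"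
  (is "?lhs = 0")
proof -
  define w where "w = boros_moll_weight m"
  define g where "g k = real k * (2 * real m + 1 - 2 * real k) * w k * real ((k - 1) choose n)" for k
  define h where "h k = (real m - real k) * (real m + real k + 1) * w k * real (k choose n)" for k
  have "?lhs = (\<Sum>k\<le>m. w k *
      ((real m - real n) * (real m + real n + 1) * real (k choose n)
       - (real n + 1) * (2 * real m + 1) * real (k choose Suc n)
       + (real n + 1) * (real n + 2) * real (k choose Suc (Suc n))))"
    unfolding boros_moll_coeff_weight w_def
    by (simp add: sum_distrib_left sum_subtractf sum.distrib distrib_left right_diff_distrib mult_ac)
  also have "\<dots> = (\<Sum>k\<le>m. h k) - (\<Sum>k\<le>m. g k)"
    unfolding boros_moll_operator_binomial g_def h_def sum_subtractf[symmetric]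
    by (simp add: right_diff_distrib mult_ac)
  also have "(\<Sum>k\<le>m. h k) = (\<Sum>k<m. h k)"
    by (simp add: h_def lessThan_Suc_atMost[symmetric])
  also have "\<dots> = (\<Sum>k<m. g (Suc k))"
  proof (rule sum.cong)
    fix k assume "k \<in> {..<m}"
    then have "h k = real (Suc k) * (2 * real m - 2 * real k - 1) * w (Suc k) * real (k choose n)"
      unfolding h_def w_def by (subst boros_moll_weight_Suc) simp_all
    also have "\<dots> = g (Suc k)"
      by (simp add: g_def)
    finally show "h k = g (Suc k)" .
  qed simp
  also have "(\<Sum>k\<le>m. g k) = (\<Sum>k<m. g (Suc k))"
    by (simp add: sum.atMost_shift g_def)
  finally show ?thesis
    by simp
qed

lemma fact_boros_moll_coeff_recurrence:
  "fact (n + 2) * boros_moll_coeff (n + 2) m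
     = (2 * real m + 1) * (fact (n + 1) * boros_moll_coeff (n + 1) m)
       - (real m - real n) * (real m + real n + 1) * (fact n * boros_moll_coeff n m)"
proof -
  have f: "fact (n + 2) = (real n + 1) * (real n + 2) * fact n" "fact (n + 1) = (real n + 1) * fact n"
    by (simp_all add: algebra_simps)
  show ?thesis
    using boros_moll_coeff_recurrence[of m n] unfolding f
    by algebra
qed

section \<open>The inequality\<close>

lemma fact_boros_moll_coeff_log_concave:
  assumes "n < m"
  shows "(fact n * boros_moll_coeff n m) * (fact (n + 2) * boros_moll_coeff (n + 2) m)
       < (fact (n + 1) * boros_moll_coeff (n + 1) m)\<^sup>2"
proof (rule three_term_recurrence_log_concave[where N = m and b = "2 * real m + 1"
      and c = "\<lambda>n. (real m - real n) * (real m + real n + 1)"])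
  show "fact m * boros_moll_coeff m m \<noteq> 0"
    using boros_moll_coeff_pos[of m m] by simp
  show "fact (k + 2) * boros_moll_coeff (k + 2) m
     = (2 * real m + 1) * (fact (k + 1) * boros_moll_coeff (k + 1) m)
       - (real m - real k) * (real m + real k + 1) * (fact k * boros_moll_coeff k m)" for k
    by (rule fact_boros_moll_coeff_recurrence)
  show "(real m - real (Suc k)) * (real m + real (Suc k) + 1)
      \<le> (real m - real k) * (real m + real k + 1)" for k
    by (simp add: algebra_simps)
qed (use assms in \<open>simp_all add: boros_moll_coeff_eq_0\<close>)

lemma boros_moll_D_eq:
  assumes "j \<le> m"
  shows "boros_moll_D j m
       = fact (2 * m) * fact m * 2 ^ j * (fact j * boros_moll_coeff j m) / fact (m + j)"
proof -
  have "real ((2 * m) choose (m - j)) = fact (2 * m) / (fact (m - j) * fact (m + j))"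
    using assms by (simp add: binomial_fact)
  then show ?thesis
    by (simp add: boros_moll_D_def)
qed

theorem mainTheorem2:
  fixes m i :: nat
  assumes "m \<ge> 2" and "1 \<le> i" and "i \<le> m - 1"
  shows "((real m + real i + 1) * boros_moll_D (i + 1) m)
           * ((real m - real i + 1) * boros_moll_D (i - 1) m)
         < (real m + real i) * (real m - real i + 1) * (boros_moll_D i m)\<^sup>2"
proof -
  obtain n where i: "i = n + 1"
    using assms by (metis add.commute le_Suc_ex)
  have n: "n + 2 \<le> m"
    using assms i by simp
  define e where "e j = fact j * boros_moll_coeff j m" for j
  define K :: real where "K = fact (2 * m) * fact m * 2 ^ n / fact (m + n)"
  define s where "s = real m + real i"
  have "K > 0"
    by (simp add: K_def)
  have "s > 0"
    using assms by (simp add: s_def)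
  \<comment> \<open>Relative to \<open>D\<^sub>i\<^sub>-\<^sub>1\<close>, each step multiplies by \<open>2\<close> and divides by the next factor of the factorial.\<close>
  have D: "boros_moll_D (i - 1) m = K * e n"
    "s * boros_moll_D i m = 2 * K * e (n + 1)"
    "s * (s + 1) * boros_moll_D (i + 1) m = 4 * K * e (n + 2)"
  proof -
    have f: "fact (m + (n + 1)) = s * fact (m + n)"
      "fact (m + (n + 2)) = s * (s + 1) * fact (m + n)"
      by (simp_all add: s_def i algebra_simps)
    have D': "boros_moll_D j m = fact (2 * m) * fact m * 2 ^ j * e j / fact (m + j)"
      if "j \<le> m" for j
      using boros_moll_D_eq[OF that] by (simp add: e_def)
    have "i + 1 = n + 2"
      using i by simp
    show "boros_moll_D (i - 1) m = K * e n"
      using n D'[of n] by (simp add: K_def i)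
    show "s * boros_moll_D i m = 2 * K * e (n + 1)"
      using n D'[of "n + 1"] \<open>s > 0\<close> unfolding f i
      by (simp add: K_def)
    show "s * (s + 1) * boros_moll_D (i + 1) m = 4 * K * e (n + 2)"
      using n D'[of "n + 2"] \<open>s > 0\<close> unfolding f \<open>i + 1 = n + 2\<close>
      by (simp add: K_def)
  qed
  have "s * ((s + 1) * boros_moll_D (i + 1) m * boros_moll_D (i - 1) m) = (2 * K)\<^sup>2 * (e n * e (n + 2))"
    using D by algebra
  also have "\<dots> < (2 * K)\<^sup>2 * (e (n + 1))\<^sup>2"
    using fact_boros_moll_coeff_log_concave[of n m] n \<open>K > 0\<close>
    by (intro mult_strict_left_mono) (simp_all add: e_def)
  also have "\<dots> = s * (s * (boros_moll_D i m)\<^sup>2)"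
    using D(2) by algebra
  finally have "(s + 1) * boros_moll_D (i + 1) m * boros_moll_D (i - 1) m < s * (boros_moll_D i m)\<^sup>2"
    using \<open>s > 0\<close> by simp
  then have "(real m - real i + 1) * ((s + 1) * boros_moll_D (i + 1) m * boros_moll_D (i - 1) m)
      < (real m - real i + 1) * (s * (boros_moll_D i m)\<^sup>2)"
    using assms by (intro mult_strict_left_mono) auto
  then show ?thesis
    by (simp add: s_def mult_ac)
qed

end
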